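(* Let $k\in[0,1)$ and let $S$ be a weakly regular AG-groupoid with left identity $e$. For fuzzy subsets $f,g$ of $S$ let $(\ast)$ denote the inequality $(f\circ_k g)\wedge(g\circ_k f)\ge f\wedge_k g$. Then the following conditions are equivalent (all types of ideals below are those of $S$): (i) $S$ is regular and intra-regular. (ii) $(\ast)$ holds for every $(\in,\in\vee q_k)$-fuzzy right ideal $f$ and every $(\in,\in\vee q_k)$-fuzzy left ideal $g$. (iii) $(\ast)$ holds for every $(\in,\in\vee q_k)$-fuzzy right ideal $f$ and every $(\in,\in\vee q_k)$-fuzzy quasi-ideal $g$. (iv) $(\ast)$ holds for every $(\in,\in\vee q_k)$-fuzzy right ideal $f$ and every $(\in,\in\vee q_k)$-fuzzy bi-ideal $g$. (v) $(\ast)$ holds for every $(\in,\in\vee q_k)$-fuzzy right ideal $f$ and every $(\in,\in\vee q_k)$-fuzzy generalized bi-ideal $g$. (vi) $(\ast)$ holds for every $(\in,\in\vee q_k)$-fuzzy left ideal $f$ and every $(\in,\in\vee q_k)$-fuzzy quasi-ideal $g$. (vii) $(\ast)$ holds for every $(\in,\in\vee q_k)$-fuzzy left ideal $f$ and every $(\in,\in\vee q_k)$-fuzzy bi-ideal $g$. (viii) $(\ast)$ holds for every $(\in,\in\vee q_k)$-fuzzy left ideal $f$ and every $(\in,\in\vee q_k)$-fuzzy generalized bi-ideal $g$. (ix) $(\ast)$ holds for all $(\in,\in\vee q_k)$-fuzzy quasi-ideals $f$ and $g$. (x) $(\ast)$ holds for every $(\in,\in\vee q_k)$-fuzzy quasi-ideal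 $f$ and every $(\in,\in\vee q_k)$-fuzzy bi-ideal $g$. (xi) $(\ast)$ holds for every $(\in,\in\vee q_k)$-fuzzy quasi-ideal $f$ and every $(\in,\in\vee q_k)$-fuzzy generalized bi-ideal $g$. (xii) $(\ast)$ holds for all $(\in,\in\vee q_k)$-fuzzy bi-ideals $f$ and $g$. (xiii) $(\ast)$ holds for every $(\in,\in\vee q_k)$-fuzzy bi-ideal $f$ and every $(\in,\in\vee q_k)$-fuzzy generalized bi-ideal $g$. (xiv) $(\ast)$ holds for all $(\in,\in\vee q_k)$-fuzzy generalized bi-ideals $f$ and $g$.
   Context: An AG-groupoid is a (non-empty) set $S$ with a binary operation satisfying $(ab)c=(cb)a$ for all $a,b,c\in S$. A left identity is an element $e$ with $ea=a$ for all $a$. $S$ is weakly regular if for each $a\in S$ there are $x,y\in S$ with $a=(ax)(ay)$; $S$ is regular if for each $a\in S$ there is $x\in S$ with $a=(ax)a$; $S$ is intra-regular if for each $a\in S$ there are $x,y\in S$ with $a=(xa^2)y$, where $a^2=aa$. A fuzzy subset of $S$ is a map $f:S\to[0,1]$; $\wedge$ denotes (pointwise) minimum, and inequalities between fuzzy subsets are pointwise. $1$ denotes the constant fuzzy subset with value $1$. The product is $(f\circ g)(a)=\sup_{a=bc}\, (f(b)\wedge g(c))$ (supremum over all $b,c\in S$ with $a=bc$), and $(f\circ g)(a)=0$ if $a$ is not a product of two elements. Further, $(f\wedge_k g)(a)=f(a)\wedge g(a)\wedge\frac{1-k}{2}$ and $(f\circ_k g)(a)=(f\circ g)(a)\wedge\frac{1-k}{2}$.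 For $x\in S$, $t\in(0,1]$: $x_t\in f$ means $f(x)\ge t$; $x_t q_k f$ means $f(x)+t+k>1$; $x_t\in\vee q_k f$ means $x_t\in f$ or $x_tq_kf$. A fuzzy subset $f$ is an $(\in,\in\vee q_k)$-fuzzy: - left (right) ideal if $y_t\in f$ implies $(xy)_t\in\vee q_k f$ (respectively $(yx)_t\in\vee q_kf$) for all $x,y\in S$, $t\in(0,1]$; equivalently $f(xy)\ge f(y)\wedge\frac{1-k}{2}$ (respectively $f(xy)\ge f(x)\wedge\frac{1-k}{2}$) for all $x,y$; - subgroupoid if $x_t\in f$ and $y_r\in f$ imply $(xy)_{t\wedge r}\in\vee q_kf$; equivalently $f(xy)\ge f(x)\wedge f(y)\wedge\frac{1-k}{2}$ for all $x,y$; - generalized bi-ideal if $x_t\in f$ and $z_r\in f$ imply $((xy)z)_{t\wedge r}\in\vee q_kf$ for all $y$; equivalently $f((xy)z)\ge f(x)\wedge f(z)\wedge\frac{1-k}{2}$ for all $x,y,z$; - bi-ideal if it is both an $(\in,\in\vee q_k)$-fuzzy subgroupoid and an $(\in,\in\vee q_k)$-fuzzy generalized bi-ideal; - quasi-ideal if $f(x)\ge (f\circ 1)(x)\wedge(1\circ f)(x)\wedge\frac{1-k}{2}$ for all $x$. *)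

theory Defs
  imports Complex_Main
begin

text \<open>The underlying set of the AG-groupoid is the whole type \<open>'a\<close>.\<close>

locale ag_groupoid =
  fixes mul :: "'a \<Rightarrow> 'a \<Rightarrow> 'a"  (infixl "\<cdot>" 70)
  assumes left_invertive: "(a \<cdot> b) \<cdot> c = (c \<cdot> b) \<cdot> a"

definition left_identity :: "('a \<Rightarrow> 'a \<Rightarrow> 'a) \<Rightarrow> 'a \<Rightarrow> bool" where
  "left_identity mul e \<longleftrightarrow> (\<forall>a. mul e a = a)"

definition weakly_regular :: "('a \<Rightarrow> 'a \<Rightarrow> 'a) \<Rightarrow> bool" where
  "weakly_regular mul \<longleftrightarrow> (\<forall>a. \<exists>x y. a = mul (mul a x) (mul a y))"

definition regular :: "('a \<Rightarrow> 'a \<Rightarrow> 'a) \<Rightarrow> bool" where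
  "regular mul \<longleftrightarrow> (\<forall>a. \<exists>x. a = mul (mul a x) a)"

definition intra_regular :: "('a \<Rightarrow> 'a \<Rightarrow> 'a) \<Rightarrow> bool" where
  "intra_regular mul \<longleftrightarrow> (\<forall>a. \<exists>x y. a = mul (mul x (mul a a)) y)"

definition fuzzy_subset :: "('a \<Rightarrow> real) \<Rightarrow> bool" where
  "fuzzy_subset f \<longleftrightarrow> (\<forall>x. 0 \<le> f x \<and> f x \<le> 1)"

text \<open>On fuzzy subsets the supremum below is that of a bounded set; the case distinction keeps it
  from being taken over the empty set.\<close>

definition fuzzy_prod ::
    "('a \<Rightarrow> 'a \<Rightarrow> 'a) \<Rightarrow> ('a \<Rightarrow> real) \<Rightarrow> ('a \<Rightarrow> real) \<Rightarrow> 'a \<Rightarrow> real" where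
  "fuzzy_prod mul f g a =
     (if \<exists>b c. a = mul b c
      then Sup {min (f b) (g c) | b c. a = mul b c}
      else 0)"

definition fuzzy_prod_k ::
    "('a \<Rightarrow> 'a \<Rightarrow> 'a) \<Rightarrow> real \<Rightarrow> ('a \<Rightarrow> real) \<Rightarrow> ('a \<Rightarrow> real) \<Rightarrow> 'a \<Rightarrow> real" where
  "fuzzy_prod_k mul k f g a = min (fuzzy_prod mul f g a) ((1 - k) / 2)"

definition fuzzy_meet :: "('a \<Rightarrow> real) \<Rightarrow> ('a \<Rightarrow> real) \<Rightarrow> 'a \<Rightarrow> real" where
  "fuzzy_meet f g a = min (f a) (g a)"

definition fuzzy_meet_k :: "real \<Rightarrow> ('a \<Rightarrow> real) \<Rightarrow> ('a \<Rightarrow> real) \<Rightarrow> 'a \<Rightarrow> real" where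
  "fuzzy_meet_k k f g a = min (min (f a) (g a)) ((1 - k) / 2)"

text \<open>\<open>point_in x t f\<close>, \<open>point_q k x t f\<close> and \<open>point_in_or_q k x t f\<close> express
  $x_t \in f$, $x_t q_k f$ and $x_t \in\vee q_k f$ for the fuzzy point $x_t$.\<close>

definition point_in :: "'a \<Rightarrow> real \<Rightarrow> ('a \<Rightarrow> real) \<Rightarrow> bool" where
  "point_in x t f \<longleftrightarrow> f x \<ge> t"

definition point_q :: "real \<Rightarrow> 'a \<Rightarrow> real \<Rightarrow> ('a \<Rightarrow> real) \<Rightarrow> bool" where
  "point_q k x t f \<longleftrightarrow> f x + t + k > 1"

definition point_in_or_q :: "real \<Rightarrow> 'a \<Rightarrow> real \<Rightarrow> ('a \<Rightarrow> real) \<Rightarrow> bool" where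
  "point_in_or_q k x t f \<longleftrightarrow> point_in x t f \<or> point_q k x t f"

definition fuzzy_left_ideal :: "('a \<Rightarrow> 'a \<Rightarrow> 'a) \<Rightarrow> real \<Rightarrow> ('a \<Rightarrow> real) \<Rightarrow> bool" where
  "fuzzy_left_ideal mul k f \<longleftrightarrow> fuzzy_subset f \<and>
     (\<forall>x y. \<forall>t\<in>{0<..1}. point_in y t f \<longrightarrow> point_in_or_q k (mul x y) t f)"

definition fuzzy_right_ideal :: "('a \<Rightarrow> 'a \<Rightarrow> 'a) \<Rightarrow> real \<Rightarrow> ('a \<Rightarrow> real) \<Rightarrow> bool" where
  "fuzzy_right_ideal mul k f \<longleftrightarrow> fuzzy_subset f \<and>
     (\<forall>x y. \<forall>t\<in>{0<..1}. point_in y t f \<longrightarrow> point_in_or_q k (mul y x) t f)"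

definition fuzzy_subgroupoid :: "('a \<Rightarrow> 'a \<Rightarrow> 'a) \<Rightarrow> real \<Rightarrow> ('a \<Rightarrow> real) \<Rightarrow> bool" where
  "fuzzy_subgroupoid mul k f \<longleftrightarrow> fuzzy_subset f \<and>
     (\<forall>x y. \<forall>t\<in>{0<..1}. \<forall>r\<in>{0<..1}.
        point_in x t f \<and> point_in y r f \<longrightarrow> point_in_or_q k (mul x y) (min t r) f)"

definition fuzzy_generalized_bi_ideal ::
    "('a \<Rightarrow> 'a \<Rightarrow> 'a) \<Rightarrow> real \<Rightarrow> ('a \<Rightarrow> real) \<Rightarrow> bool" where
  "fuzzy_generalized_bi_ideal mul k f \<longleftrightarrow> fuzzy_subset f \<and>
     (\<forall>x y z. \<forall>t\<in>{0<..1}. \<forall>r\<in>{0<..1}.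
        point_in x t f \<and> point_in z r f \<longrightarrow>
        point_in_or_q k (mul (mul x y) z) (min t r) f)"

definition fuzzy_bi_ideal :: "('a \<Rightarrow> 'a \<Rightarrow> 'a) \<Rightarrow> real \<Rightarrow> ('a \<Rightarrow> real) \<Rightarrow> bool" where
  "fuzzy_bi_ideal mul k f \<longleftrightarrow>
     fuzzy_subgroupoid mul k f \<and> fuzzy_generalized_bi_ideal mul k f"

definition fuzzy_quasi_ideal :: "('a \<Rightarrow> 'a \<Rightarrow> 'a) \<Rightarrow> real \<Rightarrow> ('a \<Rightarrow> real) \<Rightarrow> bool" where
  "fuzzy_quasi_ideal mul k f \<longleftrightarrow> fuzzy_subset f \<and>
     (\<forall>x. f x \<ge> min (min (fuzzy_prod mul f (\<lambda>_. 1) x) (fuzzy_prod mul (\<lambda>_. 1) f x))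
                     ((1 - k) / 2))"

definition star_ineq ::
    "('a \<Rightarrow> 'a \<Rightarrow> 'a) \<Rightarrow> real \<Rightarrow> ('a \<Rightarrow> real) \<Rightarrow> ('a \<Rightarrow> real) \<Rightarrow> bool" where
  "star_ineq mul k f g \<longleftrightarrow>
     fuzzy_meet (fuzzy_prod_k mul k f g) (fuzzy_prod_k mul k g f) \<ge> fuzzy_meet_k k f g"

end

theory Submission
  imports Defs
begin

text \<open>Weak regularity together with a left identity already forces both regularity and
  intra-regularity: \<open>a = (ax)(ay) = a\<^sup>2(xy)\<close> by the medial law, so every product \<open>as\<close> lies in \<open>(aS)a\<close>.
  Hence condition (i) always holds. Since moreover \<open>sa\<close> lies in \<open>aS\<close>, each kind of fuzzy ideal is a
  fuzzy generalized bi-ideal, and \<open>a\<close> is a product of two elements of \<open>(aS)a\<close>, which gives the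
  inequality for arbitrary fuzzy generalized bi-ideals.\<close>

section \<open>Fuzzy points and level inequalities\<close>

text \<open>The decisive level is \<open>t = min m ((1 - k) / 2)\<close>. There
  \<open>2 * t \<le> 1 - k\<close>, so even the alternative \<open>f w + t + k > 1\<close> forces
  \<open>f w \<ge> t\<close>. Conversely, a level above \<open>(1 - k) / 2\<close> is covered by
  \<open>point_q\<close> as soon as \<open>f w \<ge> (1 - k) / 2\<close>.\<close>

lemma point_in_or_q_iff:
  assumes "0 \<le> f w" and "m \<le> 1" and "0 \<le> k"
  shows "(\<forall>t\<in>{0<..1}. t \<le> m \<longrightarrow> point_in_or_q k w t f) \<longleftrightarrow> min m ((1 - k) / 2) \<le> f w"
proof
  assume *: "\<forall>t\<in>{0<..1}. t \<le> m \<longrightarrow> point_in_or_q k w t f"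
  let ?t = "min m ((1 - k) / 2)"
  show "?t \<le> f w"
  \<comment> \<open>Fuzzy points only have positive levels, so a nonpositive \<open>?t\<close> is
    settled by \<open>0 \<le> f w\<close> instead.\<close>
  proof (cases "?t \<le> 0")
    case False
    then have "0 < ?t" "?t \<le> 1" "?t \<le> m"
      using assms by linarith+
    with * have "point_in_or_q k w ?t f"
      by simp
    then show ?thesis
      by (auto simp: point_in_or_q_def point_in_def point_q_def min_def field_simps split: if_splits)
  qed (use assms in linarith)
next
  assume "min m ((1 - k) / 2) \<le> f w"
  then show "\<forall>t\<in>{0<..1}. t \<le> m \<longrightarrow> point_in_or_q k w t f"
    by (auto simp: point_in_or_q_def point_in_def point_q_def min_def field_simps split: if_splits)
qed

text \<open>Two levels reduce to one: take \<open>r = t\<close> in one direction and the level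
  \<open>min t r\<close> in the other. Then \<open>point_in_or_q_iff\<close> applies with
  \<open>m = min (f x) (f z)\<close>.\<close>

lemma point_in_or_q_min_iff:
  assumes "fuzzy_subset f" and "0 \<le> k"
  shows "(\<forall>t\<in>{0<..1}. \<forall>r\<in>{0<..1}. point_in x t f \<and> point_in z r f \<longrightarrow> point_in_or_q k w (min t r) f)
    \<longleftrightarrow> min (min (f x) (f z)) ((1 - k) / 2) \<le> f w" (is "?L \<longleftrightarrow> ?R")
proof -
  have "?L \<longleftrightarrow> (\<forall>t\<in>{0<..1}. t \<le> min (f x) (f z) \<longrightarrow> point_in_or_q k w t f)" (is "_ \<longleftrightarrow> ?M")
  proof
    show "?L \<Longrightarrow> ?M"
      by (metis min.bounded_iff min.idem point_in_def)
    assume ?M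
    show ?L
    proof (intro ballI impI)
      fix t r :: real
      assume "t \<in> {0<..1}" "r \<in> {0<..1}" "point_in x t f \<and> point_in z r f"
      then have "min t r \<in> {0<..1}" "min t r \<le> min (f x) (f z)"
        by (auto simp: point_in_def min_def)
      with \<open>?M\<close> show "point_in_or_q k w (min t r) f"
        by blast
    qed
  qed
  also have "\<dots> \<longleftrightarrow> ?R"
    using assms by (intro point_in_or_q_iff) (auto simp: fuzzy_subset_def min_le_iff_disj)
  finally show ?thesis .
qed

lemma fuzzy_left_ideal_iff:
  assumes "0 \<le> k"
  shows "fuzzy_left_ideal mul k f \<longleftrightarrow>
    fuzzy_subset f \<and> (\<forall>x y. min (f y) ((1 - k) / 2) \<le> f (mul x y))"
  using point_in_or_q_iff[of f, OF _ _ assms]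
  unfolding fuzzy_left_ideal_def fuzzy_subset_def point_in_def by meson

lemma fuzzy_right_ideal_iff:
  assumes "0 \<le> k"
  shows "fuzzy_right_ideal mul k f \<longleftrightarrow>
    fuzzy_subset f \<and> (\<forall>x y. min (f y) ((1 - k) / 2) \<le> f (mul y x))"
  using point_in_or_q_iff[of f, OF _ _ assms]
  unfolding fuzzy_right_ideal_def fuzzy_subset_def point_in_def by meson

lemma fuzzy_generalized_bi_ideal_iff:
  assumes "0 \<le> k"
  shows "fuzzy_generalized_bi_ideal mul k f \<longleftrightarrow> fuzzy_subset f \<and>
    (\<forall>x y z. min (min (f x) (f z)) ((1 - k) / 2) \<le> f (mul (mul x y) z))"
  using point_in_or_q_min_iff[of f, OF _ assms]
  unfolding fuzzy_generalized_bi_ideal_def by (simp cong: conj_cong)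

text \<open>Since \<open>f \<le> 1\<close>, the set of minima is bounded above, so the real
  \<open>Sup\<close> really is an upper bound. This is how every lower bound on a product is
  obtained from a single factorization.\<close>

lemma fuzzy_prod_ge:
  assumes "fuzzy_subset f" and "a = mul b c"
  shows "min (f b) (g c) \<le> fuzzy_prod mul f g a"
proof -
  have "bdd_above {min (f b) (g c) | b c. a = mul b c}"
    using assms(1) by (auto intro!: bdd_aboveI[of _ 1] simp: fuzzy_subset_def min_le_iff_disj)
  moreover have "min (f b) (g c) \<in> {min (f b) (g c) | b c. a = mul b c}"
    using assms(2) by blast
  ultimately show ?thesis
    using assms(2) by (auto simp: fuzzy_prod_def intro: cSup_upper)
qed

lemma fuzzy_subset_one: "fuzzy_subset (\<lambda>_. 1)"
  by (simp add: fuzzy_subset_def)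

lemma fuzzy_right_ideal_imp_generalized_bi_ideal:
  assumes "0 \<le> k" and "fuzzy_right_ideal mul k f"
  shows "fuzzy_generalized_bi_ideal mul k f"
proof -
  have f: "fuzzy_subset f" "min (f u) ((1 - k) / 2) \<le> f (mul u v)" for u v
    using assms by (auto simp: fuzzy_right_ideal_iff)
  have "min (min (f x) (f z)) ((1 - k) / 2) \<le> f (mul (mul x y) z)" for x y z
    using f(2)[of x y] f(2)[of "mul x y" z] by linarith
  then show ?thesis
    using f(1) assms(1) by (simp add: fuzzy_generalized_bi_ideal_iff)
qed

lemma fuzzy_left_ideal_imp_generalized_bi_ideal:
  assumes "0 \<le> k" and "fuzzy_left_ideal mul k f"
  shows "fuzzy_generalized_bi_ideal mul k f"
proof -
  have f: "fuzzy_subset f" "min (f v) ((1 - k) / 2) \<le> f (mul u v)" for u v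
    using assms by (auto simp: fuzzy_left_ideal_iff)
  have "min (min (f x) (f z)) ((1 - k) / 2) \<le> f (mul (mul x y) z)" for x y z
    using f(2)[of z "mul x y"] by linarith
  then show ?thesis
    using f(1) assms(1) by (simp add: fuzzy_generalized_bi_ideal_iff)
qed

section \<open>Weakly regular AG-groupoids with left identity\<close>

context ag_groupoid
begin

text \<open>Three uses of left invertivity: \<open>(a \<cdot> b) \<cdot> (c \<cdot> d) = ((c \<cdot>
  d) \<cdot> b) \<cdot> a = ((b \<cdot> d) \<cdot> c) \<cdot> a = (a \<cdot> c) \<cdot> (b \<cdot>
  d)\<close>.\<close>

lemma medial: "(a \<cdot> b) \<cdot> (c \<cdot> d) = (a \<cdot> c) \<cdot> (b \<cdot> d)"
  by (metis left_invertive)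

text \<open>Write the outer factors as \<open>e \<cdot> a\<close> and \<open>e \<cdot> b\<close>;
  the medial law exchanges \<open>a\<close> and \<open>b\<close>.\<close>

lemma left_commute:
  assumes "left_identity mul e"
  shows "a \<cdot> (b \<cdot> c) = b \<cdot> (a \<cdot> c)"
  using assms by (metis left_identity_def medial)

lemma paramedial:
  assumes "left_identity mul e"
  shows "(a \<cdot> b) \<cdot> (c \<cdot> d) = (d \<cdot> c) \<cdot> (b \<cdot> a)"
proof -
  have "(a \<cdot> b) \<cdot> (c \<cdot> d) = c \<cdot> ((a \<cdot> b) \<cdot> d)"
    by (rule left_commute[OF assms])
  also have "\<dots> = c \<cdot> ((d \<cdot> b) \<cdot> a)"
    by (simp only: left_invertive[of a b d])
  also have "\<dots> = (d \<cdot> b) \<cdot> (c \<cdot> a)"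
    by (rule left_commute[OF assms])
  also have "\<dots> = (d \<cdot> c) \<cdot> (b \<cdot> a)"
    by (rule medial)
  finally show ?thesis .
qed

text \<open>The form in which weak regularity enters everything below.\<close>

lemma weakly_regular_square_factor:
  assumes "weakly_regular mul"
  obtains t where "a = (a \<cdot> a) \<cdot> t"
  using assms by (metis weakly_regular_def medial)

text \<open>Replacing commutativity: a left multiple of \<open>a\<close> becomes a right multiple.
  The square \<open>a \<cdot> a\<close> taken out of \<open>a\<close> supplies two copies, one of
  which can be moved to the front.\<close>

lemma weakly_regular_left_multiple:
  assumes "left_identity mul e" and "weakly_regular mul"
  obtains s where "p \<cdot> a = a \<cdot> s"
proof -
  obtain t where "a = (a \<cdot> a) \<cdot> t"
    using weakly_regular_square_factor[OF assms(2)] .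
  then have "p \<cdot> a = (a \<cdot> a) \<cdot> (p \<cdot> t)"
    using left_commute[OF assms(1)] by metis
  also have "\<dots> = (t \<cdot> p) \<cdot> (a \<cdot> a)"
    by (rule paramedial[OF assms(1)])
  also have "\<dots> = a \<cdot> ((t \<cdot> p) \<cdot> a)"
    by (rule left_commute[OF assms(1)])
  finally show thesis
    by (rule that)
qed

text \<open>The square inside \<open>a\<close> again supplies two copies: both are moved to the
  right end, and the inner one is then turned to the front by
  \<open>weakly_regular_left_multiple\<close>.\<close>

lemma weakly_regular_right_multiple:
  assumes "left_identity mul e" and "weakly_regular mul"
  obtains q where "a \<cdot> s = (a \<cdot> q) \<cdot> a"
proof -
  obtain t where "a = (a \<cdot> a) \<cdot> t"
    using weakly_regular_square_factor[OF assms(2)] .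
  then have "a \<cdot> s = (s \<cdot> t) \<cdot> (a \<cdot> a)"
    by (metis left_invertive)
  also have "\<dots> = (a \<cdot> a) \<cdot> (t \<cdot> s)"
    by (rule paramedial[OF assms(1)])
  also have "\<dots> = ((t \<cdot> s) \<cdot> a) \<cdot> a"
    by (rule left_invertive)
  finally have "a \<cdot> s = ((t \<cdot> s) \<cdot> a) \<cdot> a" .
  moreover obtain q where "(t \<cdot> s) \<cdot> a = a \<cdot> q"
    using weakly_regular_left_multiple[OF assms] .
  ultimately show thesis
    using that by simp
qed

text \<open>Read \<open>a\<close> as the left multiple \<open>e \<cdot> a\<close>, then pass to
  \<open>a \<cdot> s\<close> and on to \<open>(a \<cdot> q) \<cdot> a\<close>.\<close>

lemma weakly_regular_imp_regular:
  assumes "left_identity mul e" and "weakly_regular mul"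
  shows "regular mul"
  unfolding regular_def
proof
  fix a
  obtain s where "e \<cdot> a = a \<cdot> s"
    using weakly_regular_left_multiple[OF assms] .
  moreover obtain q where "a \<cdot> s = (a \<cdot> q) \<cdot> a"
    using weakly_regular_right_multiple[OF assms] .
  ultimately show "\<exists>x. a = (a \<cdot> x) \<cdot> a"
    using assms(1) by (auto simp: left_identity_def)
qed

text \<open>In \<open>a = (a \<cdot> a) \<cdot> t\<close> the square equals
  \<open>e \<cdot> (a \<cdot> a)\<close>, so \<open>e\<close> and \<open>t\<close> are the
  witnesses.\<close>

lemma weakly_regular_imp_intra_regular:
  assumes "left_identity mul e" and "weakly_regular mul"
  shows "intra_regular mul"
  using assms by (metis intra_regular_def left_identity_def weakly_regular_square_factor)

lemma weakly_regular_bi_multiple_factorization: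
  assumes "left_identity mul e" and "weakly_regular mul"
  obtains p q where "a = ((a \<cdot> p) \<cdot> a) \<cdot> ((a \<cdot> q) \<cdot> a)"
proof -
  obtain x where x: "a = (a \<cdot> x) \<cdot> a"
    using weakly_regular_imp_regular[OF assms] by (auto simp: regular_def)
  obtain t where "a = (a \<cdot> a) \<cdot> t"
    using weakly_regular_square_factor[OF assms(2)] .
  \<comment> \<open>Substitute \<open>(a \<cdot> a) \<cdot> t\<close> for the last factor of
    \<open>(a \<cdot> x) \<cdot> a\<close>. This yields a third copy of \<open>a\<close>, enough for
    \<open>medial\<close> to start both factors with \<open>a\<close>.\<close>
  with x have "a = (a \<cdot> a) \<cdot> ((a \<cdot> x) \<cdot> t)"
    using left_commute[OF assms(1)] by metis
  also have "\<dots> = (a \<cdot> (a \<cdot> x)) \<cdot> (a \<cdot> t)"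
    by (rule medial)
  finally have "a = (a \<cdot> (a \<cdot> x)) \<cdot> (a \<cdot> t)" .
  moreover obtain p where "a \<cdot> (a \<cdot> x) = (a \<cdot> p) \<cdot> a"
    using weakly_regular_right_multiple[OF assms] .
  moreover obtain q where "a \<cdot> t = (a \<cdot> q) \<cdot> a"
    using weakly_regular_right_multiple[OF assms] .
  ultimately show thesis
    using that by metis
qed

text \<open>The element \<open>(x \<cdot> y) \<cdot> z\<close> ends in \<open>z\<close>, and as
  \<open>(z \<cdot> y) \<cdot> x\<close> it is also a right multiple of \<open>x\<close>. The two
  factorizations bound the two products in the quasi-ideal condition by \<open>f z\<close> and
  \<open>f x\<close>.\<close>

lemma fuzzy_quasi_ideal_imp_generalized_bi_ideal:
  assumes "left_identity mul e" and "weakly_regular mul"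
    and "0 \<le> k" and "fuzzy_quasi_ideal mul k f"
  shows "fuzzy_generalized_bi_ideal mul k f"
proof -
  have f: "fuzzy_subset f"
    and quasi: "min (min (fuzzy_prod mul f (\<lambda>_. 1) w) (fuzzy_prod mul (\<lambda>_. 1) f w)) ((1 - k) / 2) \<le> f w"
    for w
    using assms(4) by (auto simp: fuzzy_quasi_ideal_def)
  have le_one: "f w \<le> 1" for w
    using f by (simp add: fuzzy_subset_def)
  have "min (min (f x) (f z)) ((1 - k) / 2) \<le> f ((x \<cdot> y) \<cdot> z)" for x y z
  proof -
    obtain s where "(z \<cdot> y) \<cdot> x = x \<cdot> s"
      using weakly_regular_left_multiple[OF assms(1,2)] .
    then have "(x \<cdot> y) \<cdot> z = x \<cdot> s"
      by (simp add: left_invertive[of x y z])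
    from fuzzy_prod_ge[where mul = mul, OF f this, of "\<lambda>_. 1"]
    have "f x \<le> fuzzy_prod mul f (\<lambda>_. 1) ((x \<cdot> y) \<cdot> z)"
      using le_one[of x] by simp
    moreover have "f z \<le> fuzzy_prod mul (\<lambda>_. 1) f ((x \<cdot> y) \<cdot> z)"
      using fuzzy_prod_ge[OF fuzzy_subset_one refl, where b = "x \<cdot> y" and c = z and g = f and mul = mul]
        le_one[of z] by simp
    ultimately show ?thesis
      using quasi[of "(x \<cdot> y) \<cdot> z"] by linarith
  qed
  then show ?thesis
    using f assms(3) by (simp add: fuzzy_generalized_bi_ideal_iff)
qed

lemma star_ineq_generalized_bi_ideals:
  assumes "left_identity mul e" and "weakly_regular mul" and "0 \<le> k"
    and "fuzzy_generalized_bi_ideal mul k f" and "fuzzy_generalized_bi_ideal mul k g"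
  shows "star_ineq mul k f g"
proof -
  \<comment> \<open>Stated for fresh \<open>f\<close> and \<open>g\<close>, since
    \<open>star_ineq\<close> needs it for both orders of the factors.\<close>
  have le: "min (min (f a) (g a)) ((1 - k) / 2) \<le> fuzzy_prod mul f g a"
    if "fuzzy_generalized_bi_ideal mul k f" "fuzzy_generalized_bi_ideal mul k g" for f g a
  proof -
    obtain p q where pq: "a = ((a \<cdot> p) \<cdot> a) \<cdot> ((a \<cdot> q) \<cdot> a)"
      using weakly_regular_bi_multiple_factorization[OF assms(1,2)] .
    have f: "fuzzy_subset f" and "min (min (f a) (f a)) ((1 - k) / 2) \<le> f ((a \<cdot> p) \<cdot> a)"
      using that(1) unfolding fuzzy_generalized_bi_ideal_iff[OF assms(3)] by blast+
    moreover have "min (min (g a) (g a)) ((1 - k) / 2) \<le> g ((a \<cdot> q) \<cdot> a)"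
      using that(2) unfolding fuzzy_generalized_bi_ideal_iff[OF assms(3)] by blast
    ultimately show ?thesis
      using fuzzy_prod_ge[where mul = mul, OF f pq, of g] by linarith
  qed
  show ?thesis
    unfolding star_ineq_def le_fun_def fuzzy_meet_def fuzzy_meet_k_def fuzzy_prod_k_def
    using le[OF assms(4,5)] le[OF assms(5,4)]
    by (metis min.bounded_iff min.cobounded2 min.commute)
qed

end

theorem theorem22:
  fixes mul :: "'a \<Rightarrow> 'a \<Rightarrow> 'a" and e :: 'a and k :: real
  assumes "0 \<le> k" and "k < 1"
    and "ag_groupoid mul"
    and "left_identity mul e"
    and "weakly_regular mul"
  shows
    "(regular mul \<and> intra_regular mul \<longleftrightarrow>
        (\<forall>f g. fuzzy_right_ideal mul k f \<and> fuzzy_left_ideal mul k g \<longrightarrow> star_ineq mul k f g)) \<and>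
     (regular mul \<and> intra_regular mul \<longleftrightarrow>
        (\<forall>f g. fuzzy_right_ideal mul k f \<and> fuzzy_quasi_ideal mul k g \<longrightarrow> star_ineq mul k f g)) \<and>
     (regular mul \<and> intra_regular mul \<longleftrightarrow>
        (\<forall>f g. fuzzy_right_ideal mul k f \<and> fuzzy_bi_ideal mul k g \<longrightarrow> star_ineq mul k f g)) \<and>
     (regular mul \<and> intra_regular mul \<longleftrightarrow>
        (\<forall>f g. fuzzy_right_ideal mul k f \<and> fuzzy_generalized_bi_ideal mul k g \<longrightarrow> star_ineq mul k f g)) \<and>
     (regular mul \<and> intra_regular mul \<longleftrightarrow>
        (\<forall>f g. fuzzy_left_ideal mul k f \<and> fuzzy_quasi_ideal mul k g \<longrightarrow> star_ineq mul k f g)) \<and>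
     (regular mul \<and> intra_regular mul \<longleftrightarrow>
        (\<forall>f g. fuzzy_left_ideal mul k f \<and> fuzzy_bi_ideal mul k g \<longrightarrow> star_ineq mul k f g)) \<and>
     (regular mul \<and> intra_regular mul \<longleftrightarrow>
        (\<forall>f g. fuzzy_left_ideal mul k f \<and> fuzzy_generalized_bi_ideal mul k g \<longrightarrow> star_ineq mul k f g)) \<and>
     (regular mul \<and> intra_regular mul \<longleftrightarrow>
        (\<forall>f g. fuzzy_quasi_ideal mul k f \<and> fuzzy_quasi_ideal mul k g \<longrightarrow> star_ineq mul k f g)) \<and>
     (regular mul \<and> intra_regular mul \<longleftrightarrow>
        (\<forall>f g. fuzzy_quasi_ideal mul k f \<and> fuzzy_bi_ideal mul k g \<longrightarrow> star_ineq mul k f g)) \<and>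
     (regular mul \<and> intra_regular mul \<longleftrightarrow>
        (\<forall>f g. fuzzy_quasi_ideal mul k f \<and> fuzzy_generalized_bi_ideal mul k g \<longrightarrow> star_ineq mul k f g)) \<and>
     (regular mul \<and> intra_regular mul \<longleftrightarrow>
        (\<forall>f g. fuzzy_bi_ideal mul k f \<and> fuzzy_bi_ideal mul k g \<longrightarrow> star_ineq mul k f g)) \<and>
     (regular mul \<and> intra_regular mul \<longleftrightarrow>
        (\<forall>f g. fuzzy_bi_ideal mul k f \<and> fuzzy_generalized_bi_ideal mul k g \<longrightarrow> star_ineq mul k f g)) \<and>
     (regular mul \<and> intra_regular mul \<longleftrightarrow>
        (\<forall>f g. fuzzy_generalized_bi_ideal mul k f \<and> fuzzy_generalized_bi_ideal mul k g \<longrightarrow> star_ineq mul k f g))"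
proof -
  interpret ag_groupoid mul
    by (rule assms)
  note S = assms(4,5)
  have "regular mul \<and> intra_regular mul"
    using weakly_regular_imp_regular[OF S] weakly_regular_imp_intra_regular[OF S] by blast
  moreover have "fuzzy_bi_ideal mul k f \<Longrightarrow> fuzzy_generalized_bi_ideal mul k f" for f
    by (simp add: fuzzy_bi_ideal_def)
  \<comment> \<open>Every equivalence joins two true statements: each kind of ideal that occurs is a
    generalized bi-ideal, so one inequality covers all pairs.\<close>
  ultimately show ?thesis
    using star_ineq_generalized_bi_ideals[OF S assms(1)]
      fuzzy_right_ideal_imp_generalized_bi_ideal[OF assms(1), of mul]
      fuzzy_left_ideal_imp_generalized_bi_ideal[OF assms(1), of mul]
      fuzzy_quasi_ideal_imp_generalized_bi_ideal[OF S assms(1)]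
    by blast
qed

end
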